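(* Let $G$ be a finite nonabelian simple group, $M$ a maximal subgroup of $G$, $g_0\in G\setminus M$, and let $\mathcal{D}=(\mathcal{P},\mathcal{B})$ be the $1$-design with $\mathcal{P}=\{M^g:g\in G\}$ and $\mathcal{B}=\{\Delta^g: g\in G\}$, where $\Delta=\{M^{g_0g}:g\in M\}$. Then $G\cong \widetilde{G}\leq AD(G)\leq \mathrm{Aut}(\mathcal{D})$ (as groups of permutations of $\mathcal{P}$).
   Context: For $x\in G$ and a subgroup $H\le G$, $H^x=x^{-1}Hx$; for a set $B$ of subgroups of $G$, $B^x=\{H^x:H\in B\}$. $\mathcal{D}$ is a $1$-$(|\mathcal{P}|,|\Delta|,|\Delta|)$ design (every block has $|\Delta|$ points and every point lies in exactly $|\Delta|$ blocks). $\mathrm{Aut}(\mathcal{D})$ is the group of permutations of $\mathcal{P}$ that map blocks to blocks. For $x\in G$, $\widetilde{x}$ is the permutation $u\mapsto u^x$ of $\mathcal{P}$ (acting on blocks by $B\mapsto B^x$), and $\widetilde{G}:=\{\widetilde{x}:x\in G\}$. For $\phi\in\mathrm{Aut}(G)$, $\widetilde\phi$ is the map defined by $\widetilde\phi(u):=\phi(u)$ for $u\in\mathcal{P}$ (the image of the subgroup $u$ under $\phi$) and $\widetilde\phi(B):=\{\phi(v):v\in B\}$ for subsets $B$ of $\mathcal{P}$. Finally, $$AD(G):=\{\widetilde\phi: \phi\in\mathrm{Aut}(G) \text{ such that } \phi(M)=M^x \text{ and } \widetilde\phi(\Delta)=\Delta^x \text{ for some } x\in G\}.$$ *)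

theory Defs
  imports "HOL-Algebra.SimpleGroups" "HOL-Algebra.Bij"
begin

definition maximal_subgroup :: "'a set \<Rightarrow> ('a, 'b) monoid_scheme \<Rightarrow> bool" where
  "maximal_subgroup M G \<longleftrightarrow>
     subgroup M G \<and> M \<noteq> carrier G \<and>
     (\<forall>K. subgroup K G \<and> M \<subseteq> K \<longrightarrow> K = M \<or> K = carrier G)"

text \<open>Conjugation is on the right throughout: \<open>H\<^sup>x = x\<^sup>-\<^sup>1 H x\<close>.\<close>

definition conj_sub :: "('a, 'b) monoid_scheme \<Rightarrow> 'a set \<Rightarrow> 'a \<Rightarrow> 'a set" where
  "conj_sub G H x = inv\<^bsub>G\<^esub> x <#\<^bsub>G\<^esub> (H #>\<^bsub>G\<^esub> x)"

definition conj_block :: "('a, 'b) monoid_scheme \<Rightarrow> 'a set set \<Rightarrow> 'a \<Rightarrow> 'a set set" where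
  "conj_block G B x = (\<lambda>H. conj_sub G H x) ` B"

definition points :: "('a, 'b) monoid_scheme \<Rightarrow> 'a set \<Rightarrow> 'a set set" where
  "points G M = {conj_sub G M g | g. g \<in> carrier G}"

definition base_block :: "('a, 'b) monoid_scheme \<Rightarrow> 'a set \<Rightarrow> 'a \<Rightarrow> 'a set set" where
  "base_block G M g\<^sub>0 = {conj_sub G M (g\<^sub>0 \<otimes>\<^bsub>G\<^esub> g) | g. g \<in> M}"

definition blocks :: "('a, 'b) monoid_scheme \<Rightarrow> 'a set \<Rightarrow> 'a \<Rightarrow> 'a set set set" where
  "blocks G M g\<^sub>0 = {conj_block G (base_block G M g\<^sub>0) g | g. g \<in> carrier G}"

text \<open>Permutations of \<open>P\<close> are, as in \<^const>\<open>Bij\<close>, functions that are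
  undefined outside \<open>P\<close>; hence the restrictions below. The action on blocks is the image.\<close>

definition design_Aut :: "'p set \<Rightarrow> 'p set set \<Rightarrow> ('p \<Rightarrow> 'p) set" where
  "design_Aut P \<B> = {f \<in> Bij P. \<forall>B \<in> \<B>. f ` B \<in> \<B>}"

definition tilde_elt :: "('a, 'b) monoid_scheme \<Rightarrow> 'a set \<Rightarrow> 'a \<Rightarrow> 'a set \<Rightarrow> 'a set" where
  "tilde_elt G M x = (\<lambda>u \<in> points G M. conj_sub G u x)"

definition tilde_group :: "('a, 'b) monoid_scheme \<Rightarrow> 'a set \<Rightarrow> ('a set \<Rightarrow> 'a set) set" where
  "tilde_group G M = tilde_elt G M ` carrier G"

definition tilde_auto ::
    "('a, 'b) monoid_scheme \<Rightarrow> 'a set \<Rightarrow> ('a \<Rightarrow> 'a) \<Rightarrow> 'a set \<Rightarrow> 'a set" where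
  "tilde_auto G M \<phi> = (\<lambda>u \<in> points G M. \<phi> ` u)"

definition AD :: "('a, 'b) monoid_scheme \<Rightarrow> 'a set \<Rightarrow> 'a \<Rightarrow> ('a set \<Rightarrow> 'a set) set" where
  "AD G M g\<^sub>0 =
     {tilde_auto G M \<phi> | \<phi>.
        \<phi> \<in> auto G \<and>
        (\<exists>x \<in> carrier G.
           \<phi> ` M = conj_sub G M x \<and>
           tilde_auto G M \<phi> ` base_block G M g\<^sub>0 = conj_block G (base_block G M g\<^sub>0) x)}"

text \<open>A set of permutations of \<open>P\<close> with the multiplication of \<^const>\<open>BijGroup\<close>,
  that is, composition from right to left.\<close>

abbreviation perm_group :: "'p set \<Rightarrow> ('p \<Rightarrow> 'p) set \<Rightarrow> ('p \<Rightarrow> 'p) monoid" where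
  "perm_group P H \<equiv> BijGroup P \<lparr>carrier := H\<rparr>"

end

theory Submission
  imports Defs "HOL-Algebra.Elementary_Groups"
begin

text \<open>
  Everything rests on one identity: an automorphism \<open>\<phi>\<close> carries \<open>H\<^sup>x\<close> to
  \<open>\<phi>(H)\<^bsup>\<phi>(x)\<^esup>\<close>, and likewise for sets of subgroups (\<open>image_conj_sub\<close>,
  \<open>image_conj_block\<close>).

  If \<open>\<phi>(M) = M\<^sup>x\<close> and \<open>\<phi>(\<Delta>) = \<Delta>\<^sup>x\<close>, then \<open>\<phi>\<close> sends \<open>M\<^sup>g\<close> to \<open>M\<^bsup>x\<phi>(g)\<^esup>\<close> and
  \<open>\<Delta>\<^sup>g\<close> to \<open>\<Delta>\<^bsup>x\<phi>(g)\<^esup>\<close>. So the induced map sends points to points and blocks to blocks; on the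
  points it is injective because \<open>\<phi>\<close> is, and onto because \<open>g \<mapsto> x\<phi>(g)\<close> is onto. The
  same identity shows that these \<open>\<phi>\<close> form a subgroup \<open>N\<close> of the automorphism group (\<open>subgroup_base_auts\<close>): a composite \<open>\<phi>\<psi>\<close> is witnessed by
  \<open>x\<phi>(y)\<close>, an inverse by \<open>\<phi>\<^sup>-\<^sup>1(x)\<^sup>-\<^sup>1\<close>. Passing from \<open>\<phi>\<close> to the induced map is a
  homomorphism on \<open>N\<close>, so its image \<open>AD(G)\<close> is a group of permutations.
  Conjugation by \<open>x\<close> lies in \<open>N\<close> with witness \<open>x\<close> itself, which puts the image of \<open>G\<close> inside \<open>AD(G)\<close>.

  Because conjugation acts on the right while permutations are composed from right to left,
  the homomorphism from \<open>G\<close> is \<open>x \<mapsto> (u \<mapsto> x u x\<^sup>-\<^sup>1)\<close>. By simplicity its kernel is trivial or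
  all of \<open>G\<close>; in the latter case \<open>M\<close> is normal, hence trivial, and a group whose trivial
  subgroup is maximal is cyclic (\<open>maximal_trivial_imp_comm_group\<close>), which is excluded.

  Finally, maps sending blocks to blocks have inverses doing the same because an injective
  self-map of the finite set of blocks is onto (\<open>subgroup_design_Aut\<close>).
\<close>

section \<open>Conjugation and its behaviour under homomorphisms\<close>

context group
begin

lemma conj_sub_eq_image:
  assumes "H \<subseteq> carrier G" "x \<in> carrier G"
  shows "conj_sub G H x = (\<lambda>h. inv x \<otimes> h \<otimes> x) ` H"
proof -
  have "inv x \<otimes> (h \<otimes> x) = inv x \<otimes> h \<otimes> x" if "h \<in> H" for h
    using that assms by (auto simp: m_assoc)
  thus ?thesis
    by (force simp: conj_sub_def l_coset_def r_coset_def)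
qed

lemma conj_sub_subset:
  assumes "H \<subseteq> carrier G" "x \<in> carrier G"
  shows "conj_sub G H x \<subseteq> carrier G"
  using assms by (auto simp: conj_sub_eq_image)

lemma conj_sub_one:
  assumes "H \<subseteq> carrier G"
  shows "conj_sub G H \<one> = H"
  using assms by (force simp: conj_sub_eq_image)

lemma conj_sub_mult:
  assumes "H \<subseteq> carrier G" "x \<in> carrier G" "y \<in> carrier G"
  shows "conj_sub G (conj_sub G H x) y = conj_sub G H (x \<otimes> y)"
proof -
  have "inv y \<otimes> (inv x \<otimes> h \<otimes> x) \<otimes> y = inv (x \<otimes> y) \<otimes> h \<otimes> (x \<otimes> y)" if "h \<in> H" for h
    using that assms by (auto simp: m_assoc inv_mult_group)
  thus ?thesis
    using assms conj_sub_subset[OF assms(1,2)] by (simp add: conj_sub_eq_image image_image)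
qed

lemma conj_block_subset:
  assumes "B \<subseteq> Pow (carrier G)" "x \<in> carrier G"
  shows "conj_block G B x \<subseteq> Pow (carrier G)"
  using assms conj_sub_subset unfolding conj_block_def by blast

lemma conj_block_one:
  assumes "B \<subseteq> Pow (carrier G)"
  shows "conj_block G B \<one> = B"
proof -
  have "conj_sub G H \<one> = H" if "H \<in> B" for H
    using that assms by (intro conj_sub_one) blast
  thus ?thesis by (simp add: conj_block_def)
qed

lemma conj_block_mult:
  assumes "B \<subseteq> Pow (carrier G)" "x \<in> carrier G" "y \<in> carrier G"
  shows "conj_block G (conj_block G B x) y = conj_block G B (x \<otimes> y)"
proof -
  have "conj_sub G (conj_sub G H x) y = conj_sub G H (x \<otimes> y)" if "H \<in> B" for H
    using that assms by (intro conj_sub_mult) blast+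
  thus ?thesis
    by (simp add: conj_block_def image_image)
qed

lemma image_conj_sub:
  assumes "\<phi> \<in> hom G G" "H \<subseteq> carrier G" "x \<in> carrier G"
  shows "\<phi> ` conj_sub G H x = conj_sub G (\<phi> ` H) (\<phi> x)"
proof -
  interpret \<phi>: group_hom G G \<phi>
    by (unfold_locales) (rule assms)
  have "\<phi> (inv x \<otimes> h \<otimes> x) = inv (\<phi> x) \<otimes> \<phi> h \<otimes> \<phi> x" if "h \<in> H" for h
    using that assms by (auto simp: subset_iff)
  moreover have "\<phi> ` H \<subseteq> carrier G"
    using assms by auto
  ultimately show ?thesis
    using assms by (simp add: conj_sub_eq_image image_image)
qed

lemma image_conj_block:
  assumes "\<phi> \<in> hom G G" "B \<subseteq> Pow (carrier G)" "x \<in> carrier G"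
  shows "(`) \<phi> ` conj_block G B x = conj_block G ((`) \<phi> ` B) (\<phi> x)"
proof -
  have "\<phi> ` conj_sub G H x = conj_sub G (\<phi> ` H) (\<phi> x)" if "H \<in> B" for H
    using that assms by (intro image_conj_sub) blast+
  thus ?thesis
    by (simp add: conj_block_def image_image)
qed

lemma autoD:
  assumes "\<phi> \<in> auto G"
  shows "\<phi> \<in> hom G G" "\<phi> \<in> Bij (carrier G)" "inj_on \<phi> (carrier G)"
    "\<phi> ` carrier G = carrier G" "\<And>x. x \<in> carrier G \<Longrightarrow> \<phi> x \<in> carrier G"
  using assms by (auto simp: auto_def Bij_def bij_betw_def)

section \<open>Automorphisms respecting the design\<close>

text \<open>For \<open>B = \<Delta>\<close> this is the group of automorphisms that induces \<open>AD(G)\<close>, so that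
  \<open>AD(G)\<close> inherits the group laws as a homomorphic image (\<open>AD_eq_image\<close>, \<open>subgroup_AD\<close>).\<close>

definition base_auts :: "'a set \<Rightarrow> 'a set set \<Rightarrow> ('a \<Rightarrow> 'a) set" where
  "base_auts M B = {\<phi> \<in> auto G. \<exists>x \<in> carrier G.
     \<phi> ` M = conj_sub G M x \<and> (`) \<phi> ` B = conj_block G B x}"

text \<open>Applying \<open>\<phi>\<close> to \<open>\<psi>(M) = M\<^sup>y\<close> gives \<open>\<phi>(M)\<^bsup>\<phi>(y)\<^esup> = M\<^bsup>x\<phi>(y)\<^esup>\<close>, and the same computation
  applies to \<open>B\<close>; hence a single witness \<open>x\<phi>(y)\<close> serves for both.\<close>

lemma subgroup_base_auts:
  assumes M: "M \<subseteq> carrier G" and B: "B \<subseteq> Pow (carrier G)"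
  shows "subgroup (base_auts M B) (AutoGroup G)"
proof (rule group.subgroupI[OF AutoGroup])
  show "base_auts M B \<subseteq> carrier (AutoGroup G)"
    by (auto simp: base_auts_def AutoGroup_def)
next
  let ?e = "\<lambda>x\<in>carrier G. x"
  have e: "?e ` H = H" if "H \<subseteq> carrier G" for H
    using that by force
  have "(`) ?e ` B = (\<lambda>H. H) ` B"
    using e B by (intro image_cong) auto
  hence "?e \<in> base_auts M B"
    using e[OF M] M B id_in_auto
    by (auto simp: base_auts_def conj_sub_one conj_block_one simp del: restrict_apply
        intro!: bexI[of _ \<one>])
  thus "base_auts M B \<noteq> {}" by blast
next
  fix \<phi> assume "\<phi> \<in> base_auts M B"
  then obtain x where \<phi>: "\<phi> \<in> auto G" and x: "x \<in> carrier G"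
    and \<phi>M: "\<phi> ` M = conj_sub G M x" and \<phi>B: "(`) \<phi> ` B = conj_block G B x"
    by (auto simp: base_auts_def)
  define \<chi> where "\<chi> = restrict (inv_into (carrier G) \<phi>) (carrier G)"
  have inv_eq: "inv\<^bsub>AutoGroup G\<^esub> \<phi> = \<chi>"
    unfolding AutoGroup_def \<chi>_def
    using group.m_inv_consistent[OF group_BijGroup subgroup_auto \<phi>] inv_BijGroup autoD(2)[OF \<phi>]
    by metis
  have \<chi>: "\<chi> \<in> auto G"
    using \<phi> unfolding \<chi>_def auto_def
    by (auto intro: restrict_inv_into_hom restrict_inv_into_Bij)
  have \<chi>\<phi>: "\<chi> ` \<phi> ` H = H" if "H \<subseteq> carrier G" for H
  proof -
    have "\<chi> (\<phi> h) = h" if "h \<in> carrier G" for h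
      using that autoD[OF \<phi>] by (simp add: \<chi>_def)
    thus ?thesis using that by (force simp: image_image subset_iff)
  qed
  define y where "y = \<chi> x"
  have y: "y \<in> carrier G" using autoD[OF \<chi>] x by (simp add: y_def)
  have \<chi>M: "\<chi> ` M \<subseteq> carrier G" using autoD(5)[OF \<chi>] M by blast
  have \<chi>B: "(`) \<chi> ` B \<subseteq> Pow (carrier G)" using autoD(5)[OF \<chi>] B by blast
  \<comment> \<open>Apply \<open>\<chi>\<close> to the two equations defining \<open>x\<close> and solve for \<open>\<chi>(M)\<close> and \<open>\<chi>(B)\<close>.\<close>
  have "M = conj_sub G (\<chi> ` M) y"
    using \<chi>\<phi>[OF M] image_conj_sub[OF autoD(1)[OF \<chi>] M x] by (simp add: \<phi>M y_def)
  hence "conj_sub G M (inv y) = \<chi> ` M"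
    using conj_sub_mult[OF \<chi>M y, of "inv y"] y \<chi>M by (simp add: conj_sub_one)
  moreover have "(`) \<chi> ` (`) \<phi> ` B = (\<lambda>H. H) ` B"
    unfolding image_image[of "(`) \<chi>" "(`) \<phi>"] using \<chi>\<phi> B by (intro image_cong) auto
  hence "B = conj_block G ((`) \<chi> ` B) y"
    using image_conj_block[OF autoD(1)[OF \<chi>] B x] by (simp add: \<phi>B y_def)
  hence "conj_block G B (inv y) = (`) \<chi> ` B"
    using conj_block_mult[OF \<chi>B y, of "inv y"] y \<chi>B by (simp add: conj_block_one)
  ultimately show "inv\<^bsub>AutoGroup G\<^esub> \<phi> \<in> base_auts M B"
    unfolding inv_eq base_auts_def using \<chi> y by (auto intro!: bexI[of _ "inv y"])
next
  fix \<phi> \<psi> assume "\<phi> \<in> base_auts M B" "\<psi> \<in> base_auts M B"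
  then obtain x y where \<phi>: "\<phi> \<in> auto G" and x: "x \<in> carrier G"
    and \<phi>M: "\<phi> ` M = conj_sub G M x" and \<phi>B: "(`) \<phi> ` B = conj_block G B x"
    and \<psi>: "\<psi> \<in> auto G" and y: "y \<in> carrier G"
    and \<psi>M: "\<psi> ` M = conj_sub G M y" and \<psi>B: "(`) \<psi> ` B = conj_block G B y"
    by (auto simp: base_auts_def)
  have mult_eq: "\<phi> \<otimes>\<^bsub>AutoGroup G\<^esub> \<psi> = compose (carrier G) \<phi> \<psi>"
    using autoD(2)[OF \<phi>] autoD(2)[OF \<psi>] by (simp add: AutoGroup_def BijGroup_def)
  have in_auto: "compose (carrier G) \<phi> \<psi> \<in> auto G"
    using monoid.m_closed[OF group.is_monoid[OF AutoGroup], of \<phi> \<psi>] \<phi> \<psi>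
    unfolding mult_eq by (simp add: AutoGroup_def)
  have comp: "compose (carrier G) \<phi> \<psi> ` H = \<phi> ` \<psi> ` H" if "H \<subseteq> carrier G" for H
    using that by (force simp: compose_def image_image subset_iff)
  have \<phi>y: "\<phi> y \<in> carrier G" using autoD(5)[OF \<phi>] y .
  have "compose (carrier G) \<phi> \<psi> ` M = conj_sub G M (x \<otimes> \<phi> y)"
    using M x y \<phi>y by (simp add: comp \<psi>M image_conj_sub[OF autoD(1)[OF \<phi>]] \<phi>M conj_sub_mult)
  moreover have "(`) (compose (carrier G) \<phi> \<psi>) ` B = (`) \<phi> ` (`) \<psi> ` B"
    unfolding image_image[of "(`) \<phi>" "(`) \<psi>"]
    by (rule image_cong[OF refl], rule comp) (use B in blast)
  hence "(`) (compose (carrier G) \<phi> \<psi>) ` B = conj_block G B (x \<otimes> \<phi> y)"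
    using B x y \<phi>y by (simp add: \<psi>B image_conj_block[OF autoD(1)[OF \<phi>]] \<phi>B conj_block_mult)
  ultimately show "\<phi> \<otimes>\<^bsub>AutoGroup G\<^esub> \<psi> \<in> base_auts M B"
    unfolding mult_eq base_auts_def using in_auto x \<phi>y by (auto intro!: bexI[of _ "x \<otimes> \<phi> y"])
qed

section \<open>The induced maps on points and blocks\<close>

lemma points_subset:
  assumes "M \<subseteq> carrier G"
  shows "points G M \<subseteq> Pow (carrier G)"
  using assms conj_sub_subset unfolding points_def by blast

lemma finite_points:
  assumes "finite (carrier G)"
  shows "finite (points G M)"
  using assms by (simp add: points_def)

lemma self_in_points:
  assumes "M \<subseteq> carrier G"
  shows "M \<in> points G M"
  using conj_sub_one[OF assms] unfolding points_def by (metis (mono_tags, lifting) mem_Collect_eq one_closed)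

lemma conj_sub_in_points:
  assumes "M \<subseteq> carrier G" "u \<in> points G M" "x \<in> carrier G"
  shows "conj_sub G u x \<in> points G M"
  using assms unfolding points_def by (auto simp: conj_sub_mult)

lemma base_block_subset_points:
  assumes "M \<subseteq> carrier G" "g \<in> carrier G"
  shows "base_block G M g \<subseteq> points G M"
  using assms unfolding base_block_def points_def by blast

lemma blocks_subset_points:
  assumes "M \<subseteq> carrier G" "g \<in> carrier G"
  shows "blocks G M g \<subseteq> Pow (points G M)"
  using base_block_subset_points[OF assms] assms
  by (auto simp: blocks_def conj_block_def intro!: conj_sub_in_points)

lemma tilde_auto_image:
  assumes "B \<subseteq> points G M"
  shows "tilde_auto G M \<phi> ` B = (`) \<phi> ` B"
  using assms by (intro image_cong) (auto simp: tilde_auto_def)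

lemma tilde_auto_Bij:
  assumes M: "M \<subseteq> carrier G" and \<phi>: "\<phi> \<in> auto G"
    and x: "x \<in> carrier G" and \<phi>M: "\<phi> ` M = conj_sub G M x"
  shows "tilde_auto G M \<phi> \<in> Bij (points G M)"
proof -
  have \<phi>g: "\<phi> ` conj_sub G M g = conj_sub G M (x \<otimes> \<phi> g)" if "g \<in> carrier G" for g
    using that M x autoD[OF \<phi>] by (simp add: image_conj_sub \<phi>M conj_sub_mult)
  have "inj_on ((`) \<phi>) (points G M)"
    using inj_on_image_eq_iff[OF autoD(3)[OF \<phi>]] points_subset[OF M]
    by (intro inj_onI) blast
  moreover have "(`) \<phi> ` points G M = points G M"
  proof (intro equalityI subsetI)
    fix u assume "u \<in> (`) \<phi> ` points G M"
    then obtain g where "g \<in> carrier G" "u = \<phi> ` conj_sub G M g"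
      by (auto simp: points_def)
    thus "u \<in> points G M"
      using \<phi>g x autoD(5)[OF \<phi>] by (auto simp: points_def)
  next
    fix u assume "u \<in> points G M"
    then obtain g where g: "g \<in> carrier G" "u = conj_sub G M g"
      by (auto simp: points_def)
    \<comment> \<open>The preimage of \<open>M\<^sup>g\<close> is \<open>M\<^sup>h\<close> for the \<open>h\<close> solving \<open>x\<phi>(h) = g\<close>.\<close>
    obtain h where h: "h \<in> carrier G" "\<phi> h = inv x \<otimes> g"
      using autoD(4)[OF \<phi>] g x by (metis image_iff inv_closed m_closed)
    have "u = \<phi> ` conj_sub G M h"
      using \<phi>g[OF h(1)] h g x by (simp add: m_assoc[symmetric])
    thus "u \<in> (`) \<phi> ` points G M"
      using h by (auto simp: points_def)
  qed
  ultimately show ?thesis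
    by (auto simp: Bij_def tilde_auto_def bij_betw_def inj_on_def)
qed

lemma tilde_auto_hom:
  assumes M: "M \<subseteq> carrier G"
  shows "tilde_auto G M \<in> hom (AutoGroup G\<lparr>carrier := base_auts M B\<rparr>) (BijGroup (points G M))"
proof (rule homI)
  fix \<phi> assume "\<phi> \<in> carrier (AutoGroup G\<lparr>carrier := base_auts M B\<rparr>)"
  thus "tilde_auto G M \<phi> \<in> carrier (BijGroup (points G M))"
    using tilde_auto_Bij[OF M] by (auto simp: base_auts_def BijGroup_def)
next
  fix \<phi> \<psi>
  assume "\<phi> \<in> carrier (AutoGroup G\<lparr>carrier := base_auts M B\<rparr>)"
    and "\<psi> \<in> carrier (AutoGroup G\<lparr>carrier := base_auts M B\<rparr>)"
  hence auts: "\<phi> \<in> auto G" "\<psi> \<in> auto G"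
    and bij: "tilde_auto G M \<phi> \<in> Bij (points G M)" "tilde_auto G M \<psi> \<in> Bij (points G M)"
    using tilde_auto_Bij[OF M] by (auto simp: base_auts_def)
  have \<psi>u: "\<psi> ` u \<in> points G M" if "u \<in> points G M" for u
    using funcset_mem[OF Bij_imp_funcset[OF bij(2)] that] that by (simp add: tilde_auto_def)
  have "compose (carrier G) \<phi> \<psi> ` u = \<phi> ` \<psi> ` u" if "u \<in> points G M" for u
    using that points_subset[OF M] by (force simp: compose_def image_image subset_iff)
  hence "tilde_auto G M (compose (carrier G) \<phi> \<psi>) =
      compose (points G M) (tilde_auto G M \<phi>) (tilde_auto G M \<psi>)"
    using \<psi>u by (auto simp: tilde_auto_def compose_def fun_eq_iff)
  thus "tilde_auto G M (\<phi> \<otimes>\<^bsub>AutoGroup G\<lparr>carrier := base_auts M B\<rparr>\<^esub> \<psi>) =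
      tilde_auto G M \<phi> \<otimes>\<^bsub>BijGroup (points G M)\<^esub> tilde_auto G M \<psi>"
    using bij auts by (simp add: AutoGroup_def BijGroup_def autoD)
qed

lemma AD_eq_image:
  assumes "M \<subseteq> carrier G" "g \<in> carrier G"
  shows "AD G M g = tilde_auto G M ` base_auts M (base_block G M g)"
  by (auto simp: AD_def base_auts_def tilde_auto_image[OF base_block_subset_points[OF assms]])

lemma subgroup_AD:
  assumes M: "M \<subseteq> carrier G" and g: "g \<in> carrier G"
  shows "subgroup (AD G M g) (BijGroup (points G M))"
proof -
  let ?N = "base_auts M (base_block G M g)"
  have "subgroup ?N (AutoGroup G)"
    using base_block_subset_points[OF M g] points_subset[OF M]
    by (intro subgroup_base_auts[OF M]) blast
  then interpret t: group_hom "AutoGroup G\<lparr>carrier := ?N\<rparr>" "BijGroup (points G M)" "tilde_auto G M"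
    by (intro group_hom.intro group_hom_axioms.intro group_BijGroup tilde_auto_hom[OF M]
        subgroup.subgroup_is_group[OF _ AutoGroup])
  show ?thesis
    using t.img_is_subgroup by (simp add: AD_eq_image[OF M g])
qed

lemma AD_subset_design_Aut:
  assumes M: "M \<subseteq> carrier G" and g: "g \<in> carrier G"
  shows "AD G M g \<subseteq> design_Aut (points G M) (blocks G M g)"
proof
  let ?\<Delta> = "base_block G M g"
  have \<Delta>: "?\<Delta> \<subseteq> Pow (carrier G)"
    using base_block_subset_points[OF M g] points_subset[OF M] by blast
  fix f assume "f \<in> AD G M g"
  then obtain \<phi> x where f: "f = tilde_auto G M \<phi>" and \<phi>: "\<phi> \<in> auto G" and x: "x \<in> carrier G"
    and \<phi>M: "\<phi> ` M = conj_sub G M x" and \<phi>\<Delta>: "(`) \<phi> ` ?\<Delta> = conj_block G ?\<Delta> x"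
    unfolding AD_eq_image[OF M g] by (auto simp: base_auts_def)
  have "f ` C \<in> blocks G M g" if C: "C \<in> blocks G M g" for C
  proof -
    obtain y where y: "y \<in> carrier G" "C = conj_block G ?\<Delta> y"
      using C by (auto simp: blocks_def)
    have "f ` C = (`) \<phi> ` C"
      using C blocks_subset_points[OF M g] unfolding f by (intro tilde_auto_image) blast
    also have "\<dots> = conj_block G ?\<Delta> (x \<otimes> \<phi> y)"
      using y x \<Delta> autoD[OF \<phi>] by (simp add: image_conj_block \<phi>\<Delta> conj_block_mult)
    finally show ?thesis
      using x y autoD(5)[OF \<phi>] by (auto simp: blocks_def)
  qed
  thus "f \<in> design_Aut (points G M) (blocks G M g)"
    using tilde_auto_Bij[OF M \<phi> x \<phi>M] by (auto simp: design_Aut_def f)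
qed

section \<open>The action of the group by conjugation\<close>

lemma inner_auto:
  assumes x: "x \<in> carrier G"
  shows "(\<lambda>h \<in> carrier G. inv x \<otimes> h \<otimes> x) \<in> auto G" (is "?c \<in> _")
proof -
  have "inv x \<otimes> (h \<otimes> k) \<otimes> x = (inv x \<otimes> h \<otimes> x) \<otimes> (inv x \<otimes> k \<otimes> x)"
    if "h \<in> carrier G" "k \<in> carrier G" for h k
  proof -
    have "x \<otimes> (inv x \<otimes> (k \<otimes> x)) = k \<otimes> x"
      using that x by (simp add: m_assoc[symmetric])
    thus ?thesis using that x by (simp add: m_assoc)
  qed
  hence "?c \<in> hom G G"
    using x by (auto simp: hom_def)
  moreover have "bij_betw ?c (carrier G) (carrier G)"
    by (rule bij_betw_byWitness[of _ "\<lambda>h. x \<otimes> h \<otimes> inv x"])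
      (use x in \<open>auto simp: m_assoc inv_solve_left inv_solve_right\<close>,
       (simp add: m_assoc[symmetric])+)
  ultimately show ?thesis
    by (auto simp: auto_def Bij_def)
qed

text \<open>The permutation attached to \<open>x\<close> is induced by the inner automorphism \<open>h \<mapsto> x\<^sup>-\<^sup>1 h x\<close>,
  which moves both \<open>M\<close> and \<open>\<Delta>\<close> by \<open>x\<close> itself.\<close>

lemma tilde_elt_in_AD:
  assumes M: "M \<subseteq> carrier G" and g: "g \<in> carrier G" and x: "x \<in> carrier G"
  shows "tilde_elt G M x \<in> AD G M g"
proof -
  let ?c = "\<lambda>h \<in> carrier G. inv x \<otimes> h \<otimes> x"
  have c: "?c ` u = conj_sub G u x" if "u \<subseteq> carrier G" for u
    unfolding conj_sub_eq_image[OF that x] using that by (intro image_cong) auto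
  have P: "u \<subseteq> carrier G" if "u \<in> points G M" for u
    using that points_subset[OF M] by blast
  have "tilde_elt G M x = tilde_auto G M ?c"
    using c P by (auto simp: tilde_elt_def tilde_auto_def fun_eq_iff)
  moreover have "(`) ?c ` base_block G M g = conj_block G (base_block G M g) x"
    unfolding conj_block_def
    using c P base_block_subset_points[OF M g] by (intro image_cong) auto
  ultimately show ?thesis
    unfolding AD_eq_image[OF M g] base_auts_def
    using inner_auto[OF x] c[OF M] x by blast
qed

text \<open>The inverse turns the right action by conjugation into a left action, matching
  composition from right to left.\<close>

lemma tilde_elt_inv_hom:
  assumes M: "M \<subseteq> carrier G"
  shows "(\<lambda>x. tilde_elt G M (inv x)) \<in> hom G (BijGroup (points G M))"
proof (rule homI)
  have Bij: "tilde_elt G M x \<in> Bij (points G M)" if "x \<in> carrier G" for x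
    using tilde_elt_in_AD[OF M one_closed that] AD_subset_design_Aut[OF M one_closed]
    by (auto simp: design_Aut_def)
  show "tilde_elt G M (inv x) \<in> carrier (BijGroup (points G M))" if "x \<in> carrier G" for x
    using that Bij by (simp add: BijGroup_def)
  show "tilde_elt G M (inv (x \<otimes> y)) =
      tilde_elt G M (inv x) \<otimes>\<^bsub>BijGroup (points G M)\<^esub> tilde_elt G M (inv y)"
    if x: "x \<in> carrier G" and y: "y \<in> carrier G" for x y
  proof -
    have "conj_sub G u (inv (x \<otimes> y)) = conj_sub G (conj_sub G u (inv y)) (inv x)"
      if "u \<in> points G M" for u
      using that points_subset[OF M] x y by (subst conj_sub_mult) (auto simp: inv_mult_group)
    thus ?thesis
      using x y Bij conj_sub_in_points[OF M]
      by (auto simp: BijGroup_def tilde_elt_def compose_def fun_eq_iff)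
  qed
qed

lemma tilde_group_eq_image:
  "tilde_group G M = (\<lambda>x. tilde_elt G M (inv x)) ` carrier G"
proof -
  have "(\<lambda>x. inv x) ` carrier G = carrier G"
    by (force intro: inv_inv[symmetric])
  thus ?thesis
    unfolding tilde_group_def by (metis image_image)
qed

lemma subgroup_tilde_group:
  assumes "M \<subseteq> carrier G"
  shows "subgroup (tilde_group G M) (BijGroup (points G M))"
  unfolding tilde_group_eq_image
  by (intro group_hom.img_is_subgroup group_hom.intro group_hom_axioms.intro
      group_axioms group_BijGroup tilde_elt_inv_hom assms)

text \<open>Any nontrivial element generates a subgroup strictly above the trivial one, hence
  generates the whole group.\<close>

lemma maximal_trivial_imp_comm_group:
  assumes "maximal_subgroup {\<one>} G"
  shows "comm_group G"
proof -
  obtain a where a: "a \<in> carrier G" "a \<noteq> \<one>"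
    using assms one_closed unfolding maximal_subgroup_def by blast
  have "subgroup (generate G {a}) G"
    using a by (intro generate_is_subgroup) auto
  moreover have "{\<one>} \<subseteq> generate G {a}"
    by (simp add: generate.one)
  moreover have "generate G {a} \<noteq> {\<one>}"
    using generate.incl[of a "{a}" G] a by blast
  ultimately have "generate G {a} = carrier G"
    using assms unfolding maximal_subgroup_def by blast
  hence "cyclic_group G"
    using a generate_pow[OF a(1)] by (auto simp: cyclic_group full_SetCompr_eq)
  thus ?thesis
    by (rule cyclic_imp_abelian_group)
qed

end

text \<open>An element of the kernel normalises the point \<open>M\<close>. Were the kernel all of \<open>G\<close>, then
  \<open>M\<close> would be normal, thus trivial, contradicting maximality in a nonabelian group.\<close>

lemma (in simple_group) tilde_elt_inv_inj:
  assumes max: "maximal_subgroup M G" and noncomm: "\<not> comm_group G"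
  shows "inj_on (\<lambda>x. tilde_elt G M (inv x)) (carrier G)"
proof -
  have M: "subgroup M G" "M \<subseteq> carrier G" "M \<noteq> carrier G"
    using max subgroup.subset by (auto simp: maximal_subgroup_def)
  let ?t = "\<lambda>x. tilde_elt G M (inv x)"
  interpret t: group_hom G "BijGroup (points G M)" ?t
    by (intro group_hom.intro group_hom_axioms.intro group_axioms group_BijGroup
        tilde_elt_inv_hom M)
  have "kernel G (BijGroup (points G M)) ?t \<noteq> carrier G"
  proof
    assume ker: "kernel G (BijGroup (points G M)) ?t = carrier G"
    have fixed: "conj_sub G M (inv x) = M" if "x \<in> carrier G" for x
    proof -
      have "?t x = (\<lambda>u \<in> points G M. u)"
        using that ker by (auto simp: kernel_def BijGroup_def)
      from fun_cong[OF this, of M] show ?thesis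
        using self_in_points[OF M(2)] by (simp add: tilde_elt_def)
    qed
    have "x \<otimes> h \<otimes> inv x \<in> M" if "x \<in> carrier G" "h \<in> M" for x h
    proof -
      have "x \<otimes> h \<otimes> inv x \<in> conj_sub G M (inv x)"
        using that M by (force simp: conj_sub_eq_image)
      thus ?thesis using fixed[OF that(1)] by simp
    qed
    hence "M \<lhd> G"
      using M by (intro normal_invI) auto
    hence "M = {\<one>}"
      using no_real_normal_subgroup M by blast
    thus False
      using maximal_trivial_imp_comm_group max noncomm by simp
  qed
  hence "kernel G (BijGroup (points G M)) ?t = {\<one>}"
    using no_real_normal_subgroup[OF t.normal_kernel] by blast
  thus ?thesis
    by (simp add: t.inj_iff_trivial_ker)
qed

section \<open>The automorphism group of a finite design\<close>

text \<open>A member of \<^const>\<open>design_Aut\<close> is only required to send blocks to blocks. Finiteness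
  turns this into a permutation of the blocks, so that its inverse preserves them too.\<close>

lemma subgroup_design_Aut:
  assumes fin: "finite P" and sub: "\<B> \<subseteq> Pow P"
  shows "subgroup (design_Aut P \<B>) (BijGroup P)"
proof (rule group.subgroupI[OF group_BijGroup])
  show "design_Aut P \<B> \<subseteq> carrier (BijGroup P)"
    by (auto simp: design_Aut_def BijGroup_def)
next
  have "(\<lambda>x\<in>P. x) ` B = B" if "B \<in> \<B>" for B
    using that sub by force
  hence "(\<lambda>x\<in>P. x) \<in> design_Aut P \<B>"
    using id_Bij by (auto simp: design_Aut_def)
  thus "design_Aut P \<B> \<noteq> {}" by blast
next
  fix f assume "f \<in> design_Aut P \<B>"
  hence f: "f \<in> Bij P" and fB: "\<And>B. B \<in> \<B> \<Longrightarrow> f ` B \<in> \<B>"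
    by (auto simp: design_Aut_def)
  have inj: "inj_on f P" using f by (simp add: Bij_def bij_betw_def)
  have "inj_on ((`) f) \<B>"
    using inj_on_image_eq_iff[OF inj] sub by (intro inj_onI) blast
  moreover have "finite \<B>"
    using fin sub by (meson finite_Pow_iff finite_subset)
  ultimately have onto: "(`) f ` \<B> = \<B>"
    using fB by (intro endo_inj_surj) auto
  have "(\<lambda>x\<in>P. inv_into P f x) ` B \<in> \<B>" if B: "B \<in> \<B>" for B
  proof -
    obtain C where C: "C \<in> \<B>" "B = f ` C"
      using onto B by blast
    have "(\<lambda>x\<in>P. inv_into P f x) (f c) = c" if "c \<in> C" for c
      using that C sub inj funcset_mem[OF Bij_imp_funcset[OF f], of c]
      by (auto intro!: inv_into_f_f)
    hence "(\<lambda>x\<in>P. inv_into P f x) ` B = C"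
      unfolding C(2) image_image by simp
    thus ?thesis using C by simp
  qed
  thus "inv\<^bsub>BijGroup P\<^esub> f \<in> design_Aut P \<B>"
    using f by (simp add: inv_BijGroup design_Aut_def restrict_inv_into_Bij)
next
  fix f h assume "f \<in> design_Aut P \<B>" "h \<in> design_Aut P \<B>"
  hence f: "f \<in> Bij P" "\<And>B. B \<in> \<B> \<Longrightarrow> f ` B \<in> \<B>"
    and h: "h \<in> Bij P" "\<And>B. B \<in> \<B> \<Longrightarrow> h ` B \<in> \<B>"
    by (auto simp: design_Aut_def)
  have "compose P f h ` B = f ` h ` B" if "B \<in> \<B>" for B
    unfolding image_image using that sub by (intro image_cong) (auto simp: compose_def)
  thus "f \<otimes>\<^bsub>BijGroup P\<^esub> h \<in> design_Aut P \<B>"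
    using f h by (simp add: BijGroup_def design_Aut_def compose_Bij)
qed

section \<open>The chain of permutation groups\<close>

theorem theorem3p2:
  fixes G :: "('a, 'b) monoid_scheme" and M :: "'a set" and g\<^sub>0 :: 'a
  assumes "simple_group G" and "finite (carrier G)" and "\<not> comm_group G"
    and "maximal_subgroup M G"
    and "g\<^sub>0 \<in> carrier G - M"
  defines "P \<equiv> points G M" and "\<B> \<equiv> blocks G M g\<^sub>0"
  shows "G \<cong> perm_group P (tilde_group G M)
    \<and> subgroup (tilde_group G M) (perm_group P (AD G M g\<^sub>0))
    \<and> subgroup (AD G M g\<^sub>0) (perm_group P (design_Aut P \<B>))
    \<and> subgroup (design_Aut P \<B>) (BijGroup P)"
proof -
  interpret simple_group G by (rule assms)
  have M: "M \<subseteq> carrier G"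
    using assms(4) subgroup.subset by (auto simp: maximal_subgroup_def)
  have g: "g\<^sub>0 \<in> carrier G" using assms(5) by simp
  note defs = P_def \<B>_def
  have AD: "subgroup (AD G M g\<^sub>0) (BijGroup P)"
    unfolding defs by (rule subgroup_AD[OF M g])
  have tilde: "subgroup (tilde_group G M) (BijGroup P)"
    unfolding defs by (rule subgroup_tilde_group[OF M])
  have Aut: "subgroup (design_Aut P \<B>) (BijGroup P)"
    unfolding defs
    by (intro subgroup_design_Aut finite_points assms(2) blocks_subset_points[OF M g])
  have "(\<lambda>x. tilde_elt G M (inv\<^bsub>G\<^esub> x)) \<in> iso G (perm_group P (tilde_group G M))"
    using tilde_elt_inv_hom[OF M] tilde_elt_inv_inj[OF assms(4,3)]
    by (auto simp: iso_def hom_def bij_betw_def tilde_group_eq_image defs)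
  moreover have "tilde_group G M \<subseteq> AD G M g\<^sub>0"
    using tilde_elt_in_AD[OF M g] by (auto simp: tilde_group_def)
  moreover have "AD G M g\<^sub>0 \<subseteq> design_Aut P \<B>"
    unfolding defs by (rule AD_subset_design_Aut[OF M g])
  ultimately show ?thesis
    using AD tilde Aut by (auto intro: is_isoI group.subgroup_incl[OF group_BijGroup])
qed

end
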